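(* Let $A_1,\dots,A_m,P_1,\dots,P_K\in\mathbb{R}^{n\times n}$, $b_1,\dots,b_m\in\mathbb{R}$, $\mathcal{U}=\{u\in\mathbb{R}^K:\|u\|_2\le1\}$, and consider the robust semidefinite program with ellipsoidal uncertainties $$\exists?\ X\in\mathcal{D}:\quad \Big(A_i+\sum_{k=1}^Ku_{i,k}P_k\Big)\bullet X-b_i\le0\quad\forall u_i\in\mathcal{U},\ i=1,\dots,m,$$ where $\mathcal{D}=\{X\in\mathbb{R}^{n\times n}:X\succeq0,\ \|X\|_F\le1\}$. The Dual-Subgradient Robust Optimization algorithm (described in the context) terminates with an $\epsilon$-approximate solution to this program after no more than $T=O(\sigma^2/\epsilon^2)$ calls to the SDP oracle, where $\sigma^2=\sum_{k=1}^K\|P_k\|_F^2$ is the total magnitude of the allowed noise.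
   Context: $A\bullet X=\mathrm{Tr}(A^\top X)$, and $u_{i,k}$ is the $k$-th entry of $u_i\in\mathbb{R}^K$. Write $f_i(X,u)=(A_i+\sum_{k=1}^Ku_kP_k)\bullet X-b_i$, so that $\nabla_uf_i(X,u)=(P_1\bullet X,\dots,P_K\bullet X)$. A matrix $X\in\mathcal{D}$ is an $\epsilon$-approximate solution of the robust program if $f_i(X,u_i)\le\epsilon$ for all $u_i\in\mathcal{U}$ and all $i=1,\dots,m$. SDP oracle $\mathcal{O}_\alpha$ (an $\alpha$-approximate solver for the non-robust SDP with fixed noise): given $(u_1,\dots,u_m)\in\mathcal{U}^m$, it outputs some $X\in\mathcal{D}$ with $f_i(X,u_i)\le\alpha$ for $i=1,\dots,m$, or "infeasible" if there is no $X\in\mathcal{D}$ with $f_i(X,u_i)\le0$ for $i=1,\dots,m$. Dual-Subgradient Robust Optimization. Input: target accuracy $\alpha>0$, and parameters $D,G$, where $D$ is an upper bound on the $\ell_2$ diameter of $\mathcal{U}$ and $G$ is an upper bound on $\|\nabla_uf_i(X,u)\|_2$ over $X\in\mathcal{D}$, $u\in\mathcal{U}$ and all $i$; here $D=2$ and $G=\sigma$ are used. Output specification: a $2\alpha$-approximate solution of the robust program, or "infeasible". Set $T=\lceil G^2D^2/\alpha^2\rceil$ and $\eta=D/(G\sqrt T)$. Initialize $(u_1^0,\dots,u_m^0)\in\mathcal{U}^m$ and $X^0\in\mathcal{D}$ arbitrarily. For $t=1,\dots,T$: for each $i=1,\dots,m$, set $v_{i,k}^t=u_{i,k}^{t-1}+\eta\,(P_k\bullet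 X^{t-1})$ for $k=1,\dots,K$, and $u_i^t=v_i^t/\max\{\|v_i^t\|_2,1\}$ (the Euclidean projection of $v_i^t$ onto $\mathcal{U}$); then set $X^t=\mathcal{O}_\alpha(u_1^t,\dots,u_m^t)$; if the oracle declares infeasibility, return "infeasible". After the loop, return $\bar X=\frac1T\sum_{t=1}^TX^t$. *)

theory Defs
  imports "HOL-Analysis.Analysis" "HOL-Library.Landau_Symbols"
begin

text \<open>
  Index types: \<open>'n\<close> for the rows and columns of the matrices, \<open>'k\<close> for the noise coordinates
  and \<open>'m\<close> for the constraints. The library norm on \<^typ>\<open>real ^ 'n ^ 'n\<close> is the Frobenius norm:
\<close>

lemma norm_matrix_eq_Frobenius:
  fixes X :: "real ^ 'n ^ 'm"
  shows "norm X = sqrt (\<Sum>i\<in>UNIV. \<Sum>j\<in>UNIV. (X $ i $ j)\<^sup>2)"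
  by (simp add: norm_vec_def L2_set_def sum_nonneg)

definition matrix_ip :: "real ^ 'n ^ 'n \<Rightarrow> real ^ 'n ^ 'n \<Rightarrow> real" where
  "matrix_ip A X = trace (transpose A ** X)"

definition psd :: "real ^ 'n ^ 'n \<Rightarrow> bool" where
  "psd X \<longleftrightarrow> transpose X = X \<and> (\<forall>x. 0 \<le> x \<bullet> (X *v x))"

definition sdp_domain :: "(real ^ 'n ^ 'n) set" where
  "sdp_domain = {X. psd X \<and> norm X \<le> 1}"

definition uncertainty_set :: "(real ^ 'k) set" where
  "uncertainty_set = {u. norm u \<le> 1}"

text \<open>A single constraint function, for one constraint matrix \<open>A\<close> and right-hand side \<open>b\<close>.\<close>

definition constraint ::
  "('k::finite \<Rightarrow> real ^ 'n ^ 'n) \<Rightarrow> real ^ 'n ^ 'n \<Rightarrow> real \<Rightarrow> real ^ 'n ^ 'n \<Rightarrow> real ^ 'k \<Rightarrow> real" where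
  "constraint P A b X u = matrix_ip (A + (\<Sum>k\<in>UNIV. (u $ k) *\<^sub>R P k)) X - b"

definition robust_approx_solution ::
  "('m \<Rightarrow> real ^ 'n ^ 'n) \<Rightarrow> ('k::finite \<Rightarrow> real ^ 'n ^ 'n) \<Rightarrow> ('m \<Rightarrow> real) \<Rightarrow>
    real \<Rightarrow> real ^ 'n ^ 'n \<Rightarrow> bool" where
  "robust_approx_solution A P b \<epsilon> X \<longleftrightarrow>
     X \<in> sdp_domain \<and> (\<forall>i. \<forall>u\<in>uncertainty_set. constraint P (A i) (b i) X u \<le> \<epsilon>)"

definition robust_feasible ::
  "('m \<Rightarrow> real ^ 'n ^ 'n) \<Rightarrow> ('k::finite \<Rightarrow> real ^ 'n ^ 'n) \<Rightarrow> ('m \<Rightarrow> real) \<Rightarrow> bool" where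
  "robust_feasible A P b \<longleftrightarrow>
     (\<exists>X\<in>sdp_domain. \<forall>i. \<forall>u\<in>uncertainty_set. constraint P (A i) (b i) X u \<le> 0)"

text \<open>
  \<open>None\<close> is the answer ``infeasible''. The first argument of an oracle is the number of the call,
  so that an oracle which is free to choose among several correct answers (even depending on
  earlier calls) is covered; an ordinary function of the noise vectors is the special case that
  ignores this argument.
\<close>

type_synonym ('m, 'k, 'n) sdp_oracle = "nat \<Rightarrow> ('m \<Rightarrow> real ^ 'k) \<Rightarrow> (real ^ 'n ^ 'n) option"

definition is_sdp_oracle ::
  "('m \<Rightarrow> real ^ 'n ^ 'n) \<Rightarrow> ('k::finite \<Rightarrow> real ^ 'n ^ 'n) \<Rightarrow> ('m \<Rightarrow> real) \<Rightarrow>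
    real \<Rightarrow> ('m, 'k, 'n::finite) sdp_oracle \<Rightarrow> bool" where
  "is_sdp_oracle A P b \<alpha> orc \<longleftrightarrow>
     (\<forall>t u. (\<forall>i. u i \<in> uncertainty_set) \<longrightarrow>
       (case orc t u of
          Some X \<Rightarrow> X \<in> sdp_domain \<and> (\<forall>i. constraint P (A i) (b i) X (u i) \<le> \<alpha>)
        | None \<Rightarrow> \<not> (\<exists>X\<in>sdp_domain. \<forall>i. constraint P (A i) (b i) X (u i) \<le> 0)))"

definition dual_step ::
  "('k::finite \<Rightarrow> real ^ 'n ^ 'n) \<Rightarrow> real \<Rightarrow> real ^ 'n ^ 'n \<Rightarrow> real ^ 'k \<Rightarrow> real ^ 'k" where
  "dual_step P \<eta> X u =
     (let v = (\<chi> k. u $ k + \<eta> * matrix_ip (P k) X) in (1 / max (norm v) 1) *\<^sub>R v)"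

text \<open>
  The loop with \<open>r\<close> rounds left after \<open>c\<close> oracle calls, the current iterates \<open>u\<close>, \<open>X\<close>, and the
  sum \<open>S\<close> of the oracle answers so far. It returns the final sum, or \<open>None\<close> if the oracle declared
  infeasibility, together with the total number of oracle calls made.
\<close>

primrec dual_subgradient_loop ::
  "('m, 'k, 'n) sdp_oracle \<Rightarrow> ('k::finite \<Rightarrow> real ^ 'n ^ 'n) \<Rightarrow> real \<Rightarrow> nat \<Rightarrow> nat \<Rightarrow>
    ('m \<Rightarrow> real ^ 'k) \<Rightarrow> real ^ 'n ^ 'n \<Rightarrow> real ^ 'n::finite ^ 'n \<Rightarrow>
    (real ^ 'n ^ 'n) option \<times> nat" where
  "dual_subgradient_loop orc P \<eta> 0 c u X S = (Some S, c)"
| "dual_subgradient_loop orc P \<eta> (Suc r) c u X S =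
     (let u' = (\<lambda>i. dual_step P \<eta> X (u i)) in
      case orc (Suc c) u' of
        None \<Rightarrow> (None, Suc c)
      | Some X' \<Rightarrow> dual_subgradient_loop orc P \<eta> r (Suc c) u' X' (S + X'))"

definition dual_subgradient_rounds :: "real \<Rightarrow> real \<Rightarrow> real \<Rightarrow> nat" where
  "dual_subgradient_rounds \<alpha> D G = nat \<lceil>G\<^sup>2 * D\<^sup>2 / \<alpha>\<^sup>2\<rceil>"

text \<open>
  \<open>D\<close> bounds the diameter of the uncertainty set, and \<open>G > 0\<close> the norm of the gradients of the
  constraint functions in the noise. The result is the averaged solution (\<open>None\<close> for
  ``infeasible'') together with the number of oracle calls.
\<close>

definition dual_subgradient ::
  "('m, 'k, 'n) sdp_oracle \<Rightarrow> ('k::finite \<Rightarrow> real ^ 'n ^ 'n) \<Rightarrow> real \<Rightarrow> real \<Rightarrow> real \<Rightarrow>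
    ('m \<Rightarrow> real ^ 'k) \<Rightarrow> real ^ 'n::finite ^ 'n \<Rightarrow> (real ^ 'n ^ 'n) option \<times> nat" where
  "dual_subgradient orc P \<alpha> D G u0 X0 =
     (let T = dual_subgradient_rounds \<alpha> D G;
          \<eta> = D / (G * sqrt (real T));
          (res, calls) = dual_subgradient_loop orc P \<eta> T 0 u0 X0 0
      in (map_option (\<lambda>S. (1 / real T) *\<^sub>R S) res, calls))"

end

theory Submission
  imports Defs
begin

text \<open>
  Each constraint is affine in the solution \<open>X\<close> and affine in the noise \<open>u\<close>, with gradient
  \<open>(P\<^sub>k \<bullet> X)\<^sub>k\<close> in \<open>u\<close>. For every constraint the noise player runs projected online gradient ascent
  on the unit ball, while the oracle answers each noise vector with a point that violates the
  constraints at that noise by at most \<open>\<alpha>\<close>. Online gradient ascent has small regret: summed over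
  \<open>T\<close> rounds, no fixed noise \<open>v\<close> does better than the noise vectors actually played by more than
  \<open>D\<^sup>2 / (2 \<eta>) + \<eta> T G\<^sup>2 / 2\<close>, which is \<open>D G \<surd>T\<close> for the chosen step size. So on average over the
  rounds the violation at any fixed \<open>v\<close> is at most \<open>\<alpha> + D G / \<surd>T \<le> 2 \<alpha>\<close>, and by affinity in
  \<open>X\<close> this average is the violation of the averaged solution at \<open>v\<close>. If the oracle
  ever answers ``infeasible'', the noise vectors it was given refute robust feasibility.

  The regret bound comes from the potential \<open>\<parallel>v - u\<parallel>\<^sup>2 / (2 \<eta>)\<close>: one ascent step pays for the
  instantaneous regret by decreasing it, up to \<open>\<eta> G\<^sup>2 / 2\<close> (\<open>projected_ascent_step\<close>), and the
  telescoping takes place in the induction over the loop (\<open>loop_regret\<close>). The gradient bound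
  \<open>G = \<sigma>\<close> is the Cauchy--Schwarz inequality for the Frobenius inner product.
\<close>

section \<open>Projected gradient ascent on the unit ball\<close>

definition unit_ball_proj :: "'a::real_inner \<Rightarrow> 'a" where
  "unit_ball_proj v = (1 / max (norm v) 1) *\<^sub>R v"

lemma norm_unit_ball_proj_le: "norm (unit_ball_proj v) \<le> 1"
  by (simp add: unit_ball_proj_def max_def)

text \<open>
  Outside the ball, with \<open>n = \<parallel>v\<parallel> > 1\<close>, the squared distance to \<open>w\<close> drops by
  \<open>n\<^sup>2 - 1 - 2 (1 - 1/n) (v \<bullet> w)\<close>, and \<open>v \<bullet> w \<le> n\<close> bounds this below by \<open>(n - 1)\<^sup>2\<close>.
\<close>

lemma dist_unit_ball_proj_le:
  fixes v w :: "'a::real_inner"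
  assumes "norm w \<le> 1"
  shows "(norm (w - unit_ball_proj v))\<^sup>2 \<le> (norm (w - v))\<^sup>2"
proof (cases "norm v \<le> 1")
  case True
  then show ?thesis by (simp add: unit_ball_proj_def max_def)
next
  case False
  define n where "n = norm v"
  have n: "n > 1" using False by (simp add: n_def)
  have vv: "v \<bullet> v = n\<^sup>2" by (simp add: n_def power2_norm_eq_inner)
  have "v \<bullet> w \<le> n * norm w" unfolding n_def by (rule norm_cauchy_schwarz)
  also have "\<dots> \<le> n" using n assms by (simp add: mult_left_le)
  finally have vw: "v \<bullet> w \<le> n" .
  have p: "unit_ball_proj v = (1 / n) *\<^sub>R v"
    using n by (simp add: unit_ball_proj_def n_def max_def)
  have "(norm (w - unit_ball_proj v))\<^sup>2 = w \<bullet> w - 2 * (v \<bullet> w) / n + 1"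
    unfolding p power2_norm_eq_inner using n
    by (simp add: inner_diff_left inner_diff_right inner_commute vv field_simps power2_eq_square)
  moreover have "(norm (w - v))\<^sup>2 = w \<bullet> w - 2 * (v \<bullet> w) + n\<^sup>2"
    unfolding power2_norm_eq_inner
    by (simp add: inner_diff_left inner_diff_right inner_commute vv)
  moreover have "2 * (v \<bullet> w) - 2 * (v \<bullet> w) / n \<le> 2 * n - 2"
  proof -
    have "(1 - 1 / n) * (v \<bullet> w) \<le> (1 - 1 / n) * n"
      using n vw by (intro mult_left_mono) auto
    then show ?thesis using n by (simp add: left_diff_distrib)
  qed
  moreover have "2 * n - 2 \<le> n\<^sup>2 - 1"
    using zero_le_power2[of "n - 1"] by (simp add: power2_diff)
  ultimately show ?thesis by linarith
qed

text \<open>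
  Expanding \<open>\<parallel>(v - u) - \<eta> g\<parallel>\<^sup>2\<close> produces the regret \<open>g \<bullet> (v - u)\<close> as its cross term, and
  the projection can only bring the iterate closer to \<open>v\<close>.
\<close>

lemma projected_ascent_step:
  fixes u v g :: "'a::real_inner"
  assumes "\<eta> > 0" and "norm v \<le> 1" and "norm g \<le> G"
  shows "g \<bullet> (v - u)
    \<le> ((norm (v - u))\<^sup>2 - (norm (v - unit_ball_proj (u + \<eta> *\<^sub>R g)))\<^sup>2) / (2 * \<eta>) + \<eta> * G\<^sup>2 / 2"
proof -
  have "(norm (v - unit_ball_proj (u + \<eta> *\<^sub>R g)))\<^sup>2 \<le> (norm ((v - u) - \<eta> *\<^sub>R g))\<^sup>2"
    using dist_unit_ball_proj_le[OF assms(2), of "u + \<eta> *\<^sub>R g"] by (simp add: diff_diff_eq)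
  also have "\<dots> = (norm (v - u))\<^sup>2 - 2 * \<eta> * (g \<bullet> (v - u)) + \<eta>\<^sup>2 * (norm g)\<^sup>2"
    unfolding power2_norm_eq_inner
    by (simp add: inner_diff_left inner_diff_right inner_commute algebra_simps power2_eq_square)
  also have "\<dots> \<le> (norm (v - u))\<^sup>2 - 2 * \<eta> * (g \<bullet> (v - u)) + \<eta>\<^sup>2 * G\<^sup>2"
    using assms(3) by (simp add: mult_left_mono power_mono)
  finally show ?thesis using assms(1) by (simp add: field_simps power2_eq_square)
qed

section \<open>Constraints as affine functions of solution and noise\<close>

lemma matrix_ip_eq_inner: "matrix_ip A X = A \<bullet> X"
  unfolding matrix_ip_def trace_def matrix_matrix_mult_def transpose_def inner_vec_def
  by (simp add: inner_real_def) (rule sum.swap)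

definition noise_grad :: "('k::finite \<Rightarrow> real ^ 'n ^ 'n) \<Rightarrow> real ^ 'n ^ 'n \<Rightarrow> real ^ 'k" where
  "noise_grad P X = (\<chi> k. P k \<bullet> X)"

lemma constraint_eq: "constraint P A b X u = A \<bullet> X + noise_grad P X \<bullet> u - b"
  by (simp add: constraint_def matrix_ip_eq_inner noise_grad_def inner_add_left inner_sum_left
      inner_vec_def[of _ u] mult.commute)

lemma noise_grad_add: "noise_grad P (X + Y) = noise_grad P X + noise_grad P Y"
  by (simp add: noise_grad_def vec_eq_iff inner_add_right)

lemma noise_grad_scaleR: "noise_grad P (c *\<^sub>R X) = c *\<^sub>R noise_grad P X"
  by (simp add: noise_grad_def vec_eq_iff)

lemma norm_noise_grad_le:
  fixes X :: "real ^ 'n ^ 'n"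
  assumes "norm X \<le> 1"
  shows "norm (noise_grad P X) \<le> sqrt (\<Sum>k\<in>UNIV. (norm (P k))\<^sup>2)"
proof -
  have "(P k \<bullet> X)\<^sup>2 \<le> (norm (P k))\<^sup>2" for k
  proof -
    have "\<bar>P k \<bullet> X\<bar> \<le> norm (P k) * norm X" by (rule Cauchy_Schwarz_ineq2)
    also have "\<dots> \<le> norm (P k)" using assms by (simp add: mult_left_le)
    finally show ?thesis by (simp add: abs_le_square_iff[symmetric])
  qed
  then show ?thesis
    unfolding norm_vec_def L2_set_def noise_grad_def
    by (intro real_sqrt_le_mono sum_mono) (simp add: norm_vec_def L2_set_def)
qed

lemma dual_step_eq: "dual_step P \<eta> X u = unit_ball_proj (u + \<eta> *\<^sub>R noise_grad P X)"
proof -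
  have "(\<chi> k. u $ k + \<eta> * matrix_ip (P k) X) = u + \<eta> *\<^sub>R noise_grad P X"
    by (simp add: noise_grad_def matrix_ip_eq_inner vec_eq_iff)
  then show ?thesis by (simp add: dual_step_def unit_ball_proj_def Let_def)
qed

lemma dual_step_in_uncertainty_set: "dual_step P \<eta> X u \<in> uncertainty_set"
  by (simp add: dual_step_eq uncertainty_set_def norm_unit_ball_proj_le)

section \<open>The positive semidefinite cone\<close>

lemma psd_add: "psd X \<Longrightarrow> psd Y \<Longrightarrow> psd (X + Y)"
  by (simp add: psd_def transpose_def vec_eq_iff matrix_vector_mult_add_rdistrib inner_add_right)

lemma psd_scaleR: "psd X \<Longrightarrow> 0 \<le> c \<Longrightarrow> psd (c *\<^sub>R X)"
  by (simp add: psd_def transpose_def vec_eq_iff scaleR_matrix_vector_assoc[symmetric])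

lemma psd_zero: "psd 0"
  by (simp add: psd_def transpose_def vec_eq_iff)

section \<open>Correctness of the loop\<close>

lemma is_sdp_oracleD_Some:
  assumes "is_sdp_oracle A P b \<alpha> orc" and "\<And>i. u i \<in> uncertainty_set" and "orc t u = Some X"
  shows "X \<in> sdp_domain" and "constraint P (A i) (b i) X (u i) \<le> \<alpha>"
proof -
  have "X \<in> sdp_domain \<and> (\<forall>i. constraint P (A i) (b i) X (u i) \<le> \<alpha>)"
    using assms(1)[unfolded is_sdp_oracle_def, rule_format, of u t] assms(2,3) by simp
  then show "X \<in> sdp_domain" and "constraint P (A i) (b i) X (u i) \<le> \<alpha>" by blast+
qed

lemma is_sdp_oracleD_None:
  assumes "is_sdp_oracle A P b \<alpha> orc" and "\<And>i. u i \<in> uncertainty_set" and "orc t u = None"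
  shows "\<not> robust_feasible A P b"
proof -
  have "\<not> (\<exists>X\<in>sdp_domain. \<forall>i. constraint P (A i) (b i) X (u i) \<le> 0)"
    using assms(1)[unfolded is_sdp_oracle_def, rule_format, of u t] assms(2,3) by simp
  then show ?thesis using assms(2) unfolding robust_feasible_def by blast
qed

lemma loop_calls_le:
  "dual_subgradient_loop orc P \<eta> r c u X S = (res, calls) \<Longrightarrow> calls \<le> c + r"
proof (induction r arbitrary: c u X S)
  case (Suc r)
  then show ?case by (force simp: Let_def split: option.splits)
qed simp

lemma loop_infeasible:
  assumes "is_sdp_oracle A P b \<alpha> orc"
    and "dual_subgradient_loop orc P \<eta> r c u X S = (None, calls)"
  shows "\<not> robust_feasible A P b"
  using assms(2)
proof (induction r arbitrary: c u X S)
  case (Suc r)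
  show ?case
  proof (cases "orc (Suc c) (\<lambda>i. dual_step P \<eta> X (u i))")
    case None
    show ?thesis
      by (rule is_sdp_oracleD_None[OF assms(1) dual_step_in_uncertainty_set None])
  next
    case (Some X')
    with Suc.prems
    have "dual_subgradient_loop orc P \<eta> r (Suc c) (\<lambda>i. dual_step P \<eta> X (u i)) X' (S + X')
        = (None, calls)"
      by (simp add: Let_def)
    then show ?thesis by (rule Suc.IH)
  qed
qed simp

lemma loop_sum_psd:
  assumes "is_sdp_oracle A P b \<alpha> orc"
    and "dual_subgradient_loop orc P \<eta> r c u X S = (Some S', calls)"
    and "psd S"
  shows "psd S' \<and> norm S' \<le> norm S + real r"
  using assms(2,3)
proof (induction r arbitrary: c u X S)
  case (Suc r)
  then obtain X' where X': "orc (Suc c) (\<lambda>i. dual_step P \<eta> X (u i)) = Some X'"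
    by (auto simp: Let_def split: option.splits)
  have "X' \<in> sdp_domain"
    by (rule is_sdp_oracleD_Some(1)[OF assms(1) dual_step_in_uncertainty_set X'])
  then have dom: "psd X'" "norm X' \<le> 1" by (auto simp: sdp_domain_def)
  have "dual_subgradient_loop orc P \<eta> r (Suc c) (\<lambda>i. dual_step P \<eta> X (u i)) X' (S + X')
      = (Some S', calls)"
    using Suc.prems(1) X' by (simp add: Let_def)
  then have "psd S' \<and> norm S' \<le> norm (S + X') + real r"
    by (rule Suc.IH) (intro psd_add Suc.prems(2) dom(1))
  then show ?case using norm_triangle_ineq[of S X'] dom by simp
qed simp

text \<open>
  Telescoping the step inequality over the remaining \<open>r\<close> rounds. The potential is taken at
  \<open>dual_step P \<eta> X (u i)\<close>, the noise of the upcoming round, because the loop updates the noise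
  before calling the oracle: the answer \<open>X'\<close> to that noise supplies both the violation bound
  \<open>\<alpha>\<close> there and the gradient for the next update. After the last round the loop never makes that
  next update; its potential is nonnegative and is dropped.
\<close>

lemma loop_regret:
  fixes A :: "'m \<Rightarrow> real ^ 'n ^ 'n"
  assumes orc: "is_sdp_oracle A P b \<alpha> orc"
    and \<eta>: "\<eta> > 0"
    and G: "\<And>X. X \<in> sdp_domain \<Longrightarrow> norm (noise_grad P X) \<le> G"
    and v: "v \<in> uncertainty_set"
    and "dual_subgradient_loop orc P \<eta> r c u X S = (Some S', calls)"
  shows "A i \<bullet> S' + noise_grad P S' \<bullet> v - (A i \<bullet> S + noise_grad P S \<bullet> v)
    \<le> real r * (b i + \<alpha> + \<eta> * G\<^sup>2 / 2) + (norm (v - dual_step P \<eta> X (u i)))\<^sup>2 / (2 * \<eta>)"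
  using assms(5)
proof (induction r arbitrary: c u X S)
  case 0
  then show ?case using \<eta> by simp
next
  case (Suc r)
  define u' where "u' = (\<lambda>i. dual_step P \<eta> X (u i))"
  have u': "u' i \<in> uncertainty_set" for i
    unfolding u'_def by (rule dual_step_in_uncertainty_set)
  obtain X' where X': "orc (Suc c) u' = Some X'"
    using Suc.prems by (auto simp: Let_def u'_def split: option.splits)
  have dom: "X' \<in> sdp_domain" and "constraint P (A i) (b i) X' (u' i) \<le> \<alpha>"
    by (rule is_sdp_oracleD_Some[OF orc u' X'])+
  then have con: "A i \<bullet> X' + noise_grad P X' \<bullet> u' i - b i \<le> \<alpha>"
    by (simp add: constraint_eq)
  have "dual_subgradient_loop orc P \<eta> r (Suc c) u' X' (S + X') = (Some S', calls)"
    using Suc.prems X' by (simp add: Let_def u'_def)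
  then have IH: "A i \<bullet> S' + noise_grad P S' \<bullet> v - (A i \<bullet> (S + X') + noise_grad P (S + X') \<bullet> v)
    \<le> real r * (b i + \<alpha> + \<eta> * G\<^sup>2 / 2) + (norm (v - dual_step P \<eta> X' (u' i)))\<^sup>2 / (2 * \<eta>)"
    by (rule Suc.IH)
  have step: "noise_grad P X' \<bullet> (v - u' i)
    \<le> ((norm (v - u' i))\<^sup>2 - (norm (v - dual_step P \<eta> X' (u' i)))\<^sup>2) / (2 * \<eta>) + \<eta> * G\<^sup>2 / 2"
    unfolding dual_step_eq using v
    by (intro projected_ascent_step \<eta> G dom) (simp add: uncertainty_set_def)
  have "A i \<bullet> S' + noise_grad P S' \<bullet> v - (A i \<bullet> S + noise_grad P S \<bullet> v)
    \<le> real (Suc r) * (b i + \<alpha> + \<eta> * G\<^sup>2 / 2) + (norm (v - u' i))\<^sup>2 / (2 * \<eta>)"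
    using IH step con
    by (simp add: noise_grad_add inner_add_right inner_add_left inner_diff_right
        diff_divide_distrib distrib_right)
  then show ?case by (simp add: u'_def)
qed

section \<open>Step size and number of rounds\<close>

text \<open>
  The prescribed step size balances the two parts of the regret: each equals \<open>D G \<surd>T / 2\<close>,
  and \<open>T \<ge> (D G / \<alpha>)\<^sup>2\<close> makes their sum at most \<open>\<alpha> T\<close>.
\<close>

lemma regret_le_accuracy:
  fixes D G \<alpha> :: real
  assumes "D > 0" and "G > 0" and "\<alpha> > 0"
    and "T = dual_subgradient_rounds \<alpha> D G" and "\<eta> = D / (G * sqrt (real T))"
  shows "T > 0" and "\<eta> > 0" and "real T * (\<eta> * G\<^sup>2 / 2) + D\<^sup>2 / (2 * \<eta>) \<le> real T * \<alpha>"
proof -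
  have pos: "G\<^sup>2 * D\<^sup>2 / \<alpha>\<^sup>2 > 0" using assms by simp
  have T_ge: "G\<^sup>2 * D\<^sup>2 / \<alpha>\<^sup>2 \<le> real T"
    unfolding assms(4) dual_subgradient_rounds_def by (rule real_nat_ceiling_ge)
  show T: "T > 0" using T_ge pos by (cases T) auto
  define s where "s = sqrt (real T)"
  have s: "s > 0" "real T = s\<^sup>2" using T by (auto simp: s_def)
  have \<eta>_eq: "\<eta> = D / (G * s)" unfolding assms(5) s_def ..
  show "\<eta> > 0" unfolding \<eta>_eq using assms(1,2) s(1) by simp
  have "(D * G / \<alpha>)\<^sup>2 = G\<^sup>2 * D\<^sup>2 / \<alpha>\<^sup>2"
    by (simp add: power_mult_distrib power_divide)
  also have "\<dots> \<le> s\<^sup>2" using T_ge unfolding s(2) .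
  finally have "D * G / \<alpha> \<le> s"
    by (rule power2_le_imp_le) (use s(1) in simp)
  then have DG: "D * G \<le> s * \<alpha>" using assms(3) by (simp add: field_simps)
  have "real T * (\<eta> * G\<^sup>2 / 2) + D\<^sup>2 / (2 * \<eta>) = s * (D * G)"
    unfolding s(2) \<eta>_eq using assms(1,2) s(1) by (simp add: field_simps power2_eq_square)
  also have "\<dots> \<le> s * (s * \<alpha>)" using DG s(1) by (intro mult_left_mono) auto
  finally show "real T * (\<eta> * G\<^sup>2 / 2) + D\<^sup>2 / (2 * \<eta>) \<le> real T * \<alpha>"
    unfolding s(2) by (simp add: power2_eq_square)
qed

text \<open>
  The number of rounds is \<open>\<lceil>16 s\<^sup>2 / e\<^sup>2\<rceil>\<close>, and for \<open>e \<le> s\<close> the error of rounding up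
  is at most \<open>1 \<le> s\<^sup>2 / e\<^sup>2\<close>.
\<close>

lemma rounds_bigo:
  "(\<lambda>(s, e). real (dual_subgradient_rounds (e / 2) 2 s))
     \<in> O[principal {(s, e). 0 < e \<and> e \<le> s}](\<lambda>(s, e). s\<^sup>2 / e\<^sup>2)"
proof (rule bigoI[where c = 17])
  have "real (dual_subgradient_rounds (e / 2) 2 s) \<le> 17 * (s\<^sup>2 / e\<^sup>2)"
    if "0 < e" "e \<le> s" for s e :: real
  proof -
    have "e\<^sup>2 \<le> s\<^sup>2" using that by (intro power_mono) auto
    then have "1 \<le> s\<^sup>2 / e\<^sup>2" using that by simp
    moreover have "real (dual_subgradient_rounds (e / 2) 2 s) \<le> 16 * (s\<^sup>2 / e\<^sup>2) + 1"
      unfolding dual_subgradient_rounds_def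
      using of_int_ceiling_le_add_one[of "16 * (s\<^sup>2 / e\<^sup>2)"]
      by (simp add: power_divide mult.commute of_nat_nat)
    ultimately show ?thesis by linarith
  qed
  then show "\<forall>\<^sub>F x in principal {(s, e). 0 < e \<and> e \<le> s}.
      norm (case x of (s, e) \<Rightarrow> real (dual_subgradient_rounds (e / 2) 2 s))
        \<le> 17 * norm (case x of (s, e) \<Rightarrow> s\<^sup>2 / e\<^sup>2)"
    by (auto simp: eventually_principal)
qed

section \<open>Guarantee of the algorithm\<close>

text \<open>
  Dividing the regret bound by \<open>T\<close> turns the sum of the oracle answers into their average,
  because the constraints are linear in the solution up to the constant \<open>b i\<close>.
\<close>

lemma average_robust_approx_solution:
  fixes A :: "'m \<Rightarrow> real ^ 'n ^ 'n" and P :: "'k::finite \<Rightarrow> real ^ 'n ^ 'n"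
  assumes orc: "is_sdp_oracle A P b \<alpha> orc" and "\<alpha> > 0" and "G > 0"
    and G: "\<And>X. X \<in> sdp_domain \<Longrightarrow> norm (noise_grad P X) \<le> G"
    and T_def: "T = dual_subgradient_rounds \<alpha> 2 G" and \<eta>_def: "\<eta> = 2 / (G * sqrt (real T))"
    and loop: "dual_subgradient_loop orc P \<eta> T 0 u0 X0 0 = (Some S, calls)"
  shows "robust_approx_solution A P b (2 * \<alpha>) ((1 / real T) *\<^sub>R S)"
proof -
  note T_\<eta> = regret_le_accuracy[OF _ \<open>G > 0\<close> \<open>\<alpha> > 0\<close> T_def \<eta>_def, simplified]
  have T: "real T > 0" using T_\<eta>(1) by simp
  have "psd S \<and> norm S \<le> real T"
    using loop_sum_psd[OF orc loop psd_zero] by simp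
  then have "(1 / real T) *\<^sub>R S \<in> sdp_domain"
    using T by (simp add: sdp_domain_def psd_scaleR)
  moreover have "constraint P (A i) (b i) ((1 / real T) *\<^sub>R S) v \<le> 2 * \<alpha>"
    if v: "v \<in> uncertainty_set" for i v
  proof -
    let ?d = "v - dual_step P \<eta> X0 (u0 i)"
    have "norm ?d \<le> norm v + norm (dual_step P \<eta> X0 (u0 i))" by (rule norm_triangle_ineq4)
    also have "\<dots> \<le> 2"
      using v dual_step_in_uncertainty_set[of P \<eta> X0 "u0 i"] by (simp add: uncertainty_set_def)
    finally have "(norm ?d)\<^sup>2 \<le> 2\<^sup>2" by (intro power_mono) auto
    then have "(norm ?d)\<^sup>2 / (2 * \<eta>) \<le> 2\<^sup>2 / (2 * \<eta>)"
      using T_\<eta>(2) by (intro divide_right_mono) auto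
    then have "A i \<bullet> S + noise_grad P S \<bullet> v \<le> real T * (b i + 2 * \<alpha>)"
      using loop_regret[OF orc T_\<eta>(2) G v loop, of i] T_\<eta>(3)
      by (simp add: noise_grad_def inner_vec_def[of _ v] distrib_left)
    then show ?thesis
      using T by (simp add: constraint_eq noise_grad_scaleR field_simps)
  qed
  ultimately show ?thesis by (simp add: robust_approx_solution_def)
qed

theorem corollary14:
  fixes A :: "'m::finite \<Rightarrow> real ^ 'n ^ 'n"
    and P :: "'k::finite \<Rightarrow> real ^ 'n ^ 'n"
    and b :: "'m \<Rightarrow> real"
    and \<sigma> \<epsilon> :: real
    and orc :: "('m, 'k, 'n) sdp_oracle"
    and u0 :: "'m \<Rightarrow> real ^ 'k"
    and X0 :: "real ^ 'n ^ 'n"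
    and res :: "(real ^ 'n ^ 'n) option"
    and calls :: nat
  assumes "\<sigma> > 0" and "\<sigma>\<^sup>2 = (\<Sum>k\<in>UNIV. (norm (P k))\<^sup>2)"
    and "\<epsilon> > 0"
    and "is_sdp_oracle A P b (\<epsilon> / 2) orc"
    and "\<And>i. u0 i \<in> uncertainty_set" and "X0 \<in> sdp_domain"
    and "(res, calls) = dual_subgradient orc P (\<epsilon> / 2) 2 \<sigma> u0 X0"
  shows "(case res of
            Some X \<Rightarrow> robust_approx_solution A P b \<epsilon> X
          | None \<Rightarrow> \<not> robust_feasible A P b)
    \<and> calls \<le> dual_subgradient_rounds (\<epsilon> / 2) 2 \<sigma>
    \<and> (\<lambda>(s, e). real (dual_subgradient_rounds (e / 2) 2 s))
        \<in> O[principal {(s, e). 0 < e \<and> e \<le> s}](\<lambda>(s, e). s\<^sup>2 / e\<^sup>2)"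
proof -
  define T where "T = dual_subgradient_rounds (\<epsilon> / 2) 2 \<sigma>"
  define \<eta> where "\<eta> = 2 / (\<sigma> * sqrt (real T))"
  obtain r where loop: "dual_subgradient_loop orc P \<eta> T 0 u0 X0 0 = (r, calls)"
    and res: "res = map_option (\<lambda>S. (1 / real T) *\<^sub>R S) r"
    using assms(7)
    by (auto simp: dual_subgradient_def Let_def T_def[symmetric] \<eta>_def[symmetric]
        split: prod.splits)
  have grad: "norm (noise_grad P X) \<le> \<sigma>" if "X \<in> sdp_domain" for X
  proof -
    have "norm (noise_grad P X) \<le> sqrt (\<sigma>\<^sup>2)"
      unfolding assms(2) using that by (intro norm_noise_grad_le) (simp add: sdp_domain_def)
    then show ?thesis using assms(1) by simp
  qed
  have "case res of Some X \<Rightarrow> robust_approx_solution A P b \<epsilon> X | None \<Rightarrow> \<not> robust_feasible A P b"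
  proof (cases r)
    case None
    then show ?thesis using loop_infeasible[OF assms(4)] loop res by auto
  next
    case (Some S)
    have "robust_approx_solution A P b (2 * (\<epsilon> / 2)) ((1 / real T) *\<^sub>R S)"
      using average_robust_approx_solution[OF assms(4) _ assms(1) grad T_def \<eta>_def] assms(3)
        loop Some by simp
    then show ?thesis using res Some by simp
  qed
  moreover have "calls \<le> T" using loop_calls_le[OF loop] by simp
  ultimately show ?thesis using rounds_bigo by (simp add: T_def)
qed

end
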